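(* Let $G$ be a connected graph equipped with nonnegative real edge weights ${\bf w}=\{w_e\}_{e\in E(G)}$, and let $T$ (with edge weights ${\bf w}^T$) be a Gomory--Hu tree for $(G,{\bf w})$. Then $$\Lambda(G,{\bf w})=\widehat{\Lambda}(G,{\bf w};T)=\widetilde{\Lambda}(G,{\bf w})\le \Delta_2(G,{\bf w})\le\Delta(G,{\bf w}).$$ In particular, the value of $\widehat{\Lambda}(G,{\bf w};T)$ is independent of the choice of the Gomory--Hu tree $T$.
   Context: Graphs are finite, undirected and loopless; multiple edges are allowed. The weighted degree of $x\in V(G)$ is $d_G(x,{\bf w})=\sum_{e\ni x}w_e$; $\Delta(G,{\bf w})=\max_{x}d_G(x,{\bf w})$ and $\Delta_2(G,{\bf w})=\min_{x_1\in V(G)}\max_{x\in V(G)\setminus\{x_1\}}d_G(x,{\bf w})$. For disjoint $X,Y\subseteq V(G)$, $E(X,Y)$ is the set of edges between $X$ and $Y$. For distinct $x,y$, $\lambda_G(x,y;{\bf w})$ is the maximum flow from $x$ to $y$ with edge capacities $w_e$, equivalently the minimum of $\sum_{e\in E(X,V(G)\setminus X)}w_e$ over $X\subseteq V(G)$ with $x\in X$, $y\notin X$; the maxmaxflow is $\Lambda(G,{\bf w})=\max_{x\neq y}\lambda_G(x,y;{\bf w})$. A cocycle is a set $E(X,V(G)\setminus X)$, $X\subseteq V(G)$; cocycles form a GF(2)-vector space under symmetric difference (the cocycle space), and $\widetilde{\Lambda}(G,{\bf w})=\min_{\mathcal B}\max_{C\in\mathcal B}\sum_{e\in C}w_e$,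 the minimum over all bases $\mathcal B$ of the cocycle space. For a tree $T$ on vertex set $V(G)$ and $e\in E(T)$, the elementary cocycle of $G$ corresponding to $e$ and $T$ is $E_G(X,Y)$ where $X,Y$ are the vertex sets of the two components of $T-e$. A Gomory--Hu tree for $(G,{\bf w})$ is a tree $T$ with $V(T)=V(G)$ (not necessarily a subgraph of $G$) with nonnegative edge weights ${\bf w}^T$ such that (a) $\lambda_G(x,y;{\bf w})=\lambda_T(x,y;{\bf w}^T)$ for all distinct $x,y$, and (b) for each $e=xy\in E(T)$, the elementary cocycle $C$ of $G$ corresponding to $e$ and $T$ satisfies $\sum_{f\in C}w_f=\lambda_G(x,y;{\bf w})$. Such trees exist. Define $\widehat{\Lambda}(G,{\bf w};T)=\max_{e\in E(T)}w^T_e$. *)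

theory Defs
  imports Complex_Main "HOL-Library.Z2" "HOL-Library.Function_Algebras"
    "HOL-Library.Indicator_Function"
begin

record ('v, 'e) mgraph =
  verts :: "'v set"
  edges :: "'e set"
  ends :: "'e \<Rightarrow> 'v set"

text \<open>Finite, undirected and loopless; distinct edges may have the same pair of ends.\<close>

definition multigraph :: "('v, 'e) mgraph \<Rightarrow> bool" where
  "multigraph G \<longleftrightarrow> finite (verts G) \<and> finite (edges G) \<and>
     (\<forall>e\<in>edges G. ends G e \<subseteq> verts G \<and> card (ends G e) = 2)"

definition adj :: "('v, 'e) mgraph \<Rightarrow> ('v \<times> 'v) set" where
  "adj G = {(u, v). \<exists>e\<in>edges G. ends G e = {u, v}}"

definition reach :: "('v, 'e) mgraph \<Rightarrow> ('v \<times> 'v) set" where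
  "reach G = {(u, v). u \<in> verts G \<and> v \<in> verts G \<and> (u, v) \<in> (adj G)\<^sup>*}"

definition components :: "('v, 'e) mgraph \<Rightarrow> 'v set set" where
  "components G = verts G // reach G"

definition connected_graph :: "('v, 'e) mgraph \<Rightarrow> bool" where
  "connected_graph G \<longleftrightarrow> verts G \<noteq> {} \<and> (\<forall>u\<in>verts G. \<forall>v\<in>verts G. (u, v) \<in> reach G)"

text \<open>The edge \<open>es ! i\<close> joins \<open>vs ! i\<close> to its cyclic successor. Two parallel edges form a
  cycle of length 2.\<close>

definition is_cycle :: "('v, 'e) mgraph \<Rightarrow> 'v list \<Rightarrow> 'e list \<Rightarrow> bool" where
  "is_cycle G vs es \<longleftrightarrow> length vs \<ge> 2 \<and> length es = length vs \<and>
     distinct vs \<and> distinct es \<and> set vs \<subseteq> verts G \<and> set es \<subseteq> edges G \<and>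
     (\<forall>i<length vs. ends G (es ! i) = {vs ! i, vs ! (Suc i mod length vs)})"

definition tree :: "('v, 'e) mgraph \<Rightarrow> bool" where
  "tree T \<longleftrightarrow> multigraph T \<and> connected_graph T \<and> (\<nexists>vs es. is_cycle T vs es)"

definition delete_edge :: "('v, 'e) mgraph \<Rightarrow> 'e \<Rightarrow> ('v, 'e) mgraph" where
  "delete_edge G e = G\<lparr>edges := edges G - {e}\<rparr>"

definition edges_between :: "('v, 'e) mgraph \<Rightarrow> 'v set \<Rightarrow> 'v set \<Rightarrow> 'e set" where
  "edges_between G X Y = {e \<in> edges G. \<exists>x\<in>X. \<exists>y\<in>Y. ends G e = {x, y}}"

text \<open>Maximum of a finite set of nonnegative reals, with value 0 on the empty set. The
  convention for the empty set only matters for graphs with a single vertex.\<close>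

definition max0 :: "real set \<Rightarrow> real" where
  "max0 A = (if A = {} then 0 else Max A)"

definition wdegree :: "('v, 'e) mgraph \<Rightarrow> ('e \<Rightarrow> real) \<Rightarrow> 'v \<Rightarrow> real" where
  "wdegree G w x = (\<Sum>e | e \<in> edges G \<and> x \<in> ends G e. w e)"

definition Delta :: "('v, 'e) mgraph \<Rightarrow> ('e \<Rightarrow> real) \<Rightarrow> real" where
  "Delta G w = Max (wdegree G w ` verts G)"

definition Delta2 :: "('v, 'e) mgraph \<Rightarrow> ('e \<Rightarrow> real) \<Rightarrow> real" where
  "Delta2 G w = Min ((\<lambda>x1. max0 (wdegree G w ` (verts G - {x1}))) ` verts G)"

text \<open>For an edge \<open>e\<close> with ends \<open>u\<close>, \<open>v\<close>, the real number \<open>f e u\<close> is the net amount of flow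
  that leaves \<open>u\<close> along \<open>e\<close>, so it is minus the amount that leaves \<open>v\<close> along \<open>e\<close>.\<close>

definition is_flow ::
  "('v, 'e) mgraph \<Rightarrow> ('e \<Rightarrow> real) \<Rightarrow> 'v \<Rightarrow> 'v \<Rightarrow> ('e \<Rightarrow> 'v \<Rightarrow> real) \<Rightarrow> bool" where
  "is_flow G w x y f \<longleftrightarrow>
     (\<forall>e\<in>edges G. \<forall>u v. ends G e = {u, v} \<longrightarrow> f e u = - f e v \<and> \<bar>f e u\<bar> \<le> w e) \<and>
     (\<forall>z\<in>verts G - {x, y}. (\<Sum>e | e \<in> edges G \<and> z \<in> ends G e. f e z) = 0)"

definition flow_value :: "('v, 'e) mgraph \<Rightarrow> 'v \<Rightarrow> ('e \<Rightarrow> 'v \<Rightarrow> real) \<Rightarrow> real" where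
  "flow_value G x f = (\<Sum>e | e \<in> edges G \<and> x \<in> ends G e. f e x)"

text \<open>The supremum is a maximum: the flows, restricted to the incident pairs of edges and
  vertices, form a nonempty compact set.\<close>

definition max_flow :: "('v, 'e) mgraph \<Rightarrow> ('e \<Rightarrow> real) \<Rightarrow> 'v \<Rightarrow> 'v \<Rightarrow> real" where
  "max_flow G w x y = Sup {flow_value G x f | f. is_flow G w x y f}"

definition maxmaxflow :: "('v, 'e) mgraph \<Rightarrow> ('e \<Rightarrow> real) \<Rightarrow> real" where
  "maxmaxflow G w = max0 {max_flow G w x y | x y. x \<in> verts G \<and> y \<in> verts G \<and> x \<noteq> y}"

definition cocycles :: "('v, 'e) mgraph \<Rightarrow> 'e set set" where
  "cocycles G = {edges_between G X (verts G - X) | X. X \<subseteq> verts G}"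

text \<open>A set of edges is identified with its indicator function with values in GF(2), so that
  symmetric difference becomes pointwise addition.\<close>

definition gf2_scale :: "bit \<Rightarrow> ('e \<Rightarrow> bit) \<Rightarrow> 'e \<Rightarrow> bit" where
  "gf2_scale c f = (\<lambda>e. c * f e)"

interpretation gf2: vector_space gf2_scale
  by unfold_locales (auto simp: gf2_scale_def fun_eq_iff algebra_simps)

definition edge_vec :: "'e set \<Rightarrow> 'e \<Rightarrow> bit" where
  "edge_vec C = indicator C"

definition cocycle_basis :: "('v, 'e) mgraph \<Rightarrow> 'e set set \<Rightarrow> bool" where
  "cocycle_basis G B \<longleftrightarrow>
     gf2.independent (edge_vec ` B) \<and> gf2.span (edge_vec ` B) = edge_vec ` cocycles G"

definition Lambda_tilde :: "('v, 'e) mgraph \<Rightarrow> ('e \<Rightarrow> real) \<Rightarrow> real" where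
  "Lambda_tilde G w = Min {max0 (sum w ` B) | B. cocycle_basis G B}"

text \<open>Deleting an edge of a tree leaves exactly two components \<open>X\<close> and \<open>Y\<close>, and
  \<open>edges_between\<close> is symmetric in them, so the description is unique.\<close>

definition elementary_cocycle ::
  "('v, 'e) mgraph \<Rightarrow> ('v, 'f) mgraph \<Rightarrow> 'f \<Rightarrow> 'e set" where
  "elementary_cocycle G T e = (THE C. \<exists>X Y. X \<noteq> Y \<and>
     components (delete_edge T e) = {X, Y} \<and> C = edges_between G X Y)"

definition gomory_hu_tree ::
  "('v, 'e) mgraph \<Rightarrow> ('e \<Rightarrow> real) \<Rightarrow> ('v, 'f) mgraph \<Rightarrow> ('f \<Rightarrow> real) \<Rightarrow> bool" where
  "gomory_hu_tree G w T wT \<longleftrightarrow>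
     tree T \<and> verts T = verts G \<and> (\<forall>e\<in>edges T. 0 \<le> wT e) \<and>
     (\<forall>x\<in>verts G. \<forall>y\<in>verts G. x \<noteq> y \<longrightarrow> max_flow G w x y = max_flow T wT x y) \<and>
     (\<forall>e\<in>edges T. \<forall>x y. ends T e = {x, y} \<longrightarrow>
        sum w (elementary_cocycle G T e) = max_flow G w x y)"

definition Lambda_hat :: "('v, 'f) mgraph \<Rightarrow> ('f \<Rightarrow> real) \<Rightarrow> real" where
  "Lambda_hat T wT = max0 (wT ` edges T)"

end

theory Submission
  imports Defs
begin

text \<open>
  Only the easy inequality between flows and cuts is needed. Applied to single vertices it bounds the
  maxmaxflow by \<open>\<Delta>\<^sub>2\<close>; applied inside a tree it shows that the maximum flow between the ends
  of a tree edge is the weight of that edge.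

  A path \<open>P\<close> of \<open>G\<close> from \<open>x\<close> to \<open>y\<close> defines the linear functional \<open>C \<mapsto> |C \<inter> P| mod 2\<close> on the cocycle
  space, and on a cocycle \<open>E(X, V - X)\<close> it detects whether \<open>X\<close> separates \<open>x\<close> from \<open>y\<close>. Hence every basis
  contains a cocycle separating \<open>x\<close> from \<open>y\<close>, so its maximal weight is at least the maxmaxflow.
  The functionals belonging to the edges of a tree are dual to its elementary cocycles, which
  therefore form a basis; for a Gomory--Hu tree the weights of this basis are themselves maximum flows.
\<close>

section \<open>Cuts of a multigraph\<close>

definition cutset :: "('v, 'e) mgraph \<Rightarrow> 'v set \<Rightarrow> 'e set" where
  "cutset G X = edges_between G X (verts G - X)"

lemma multigraph_edgeE:
  assumes "multigraph G" "e \<in> edges G"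
  obtains u v where "ends G e = {u, v}" "u \<noteq> v" "u \<in> verts G" "v \<in> verts G"
proof -
  have "card (ends G e) = 2" "ends G e \<subseteq> verts G"
    using assms by (auto simp: multigraph_def)
  then show thesis
    using that by (auto simp: card_2_iff)
qed

lemma cut_subset_edges: "cutset G X \<subseteq> edges G"
  by (auto simp: cutset_def edges_between_def)

lemma finite_cut: "multigraph G \<Longrightarrow> finite (cutset G X)"
  by (rule finite_subset[OF cut_subset_edges]) (simp add: multigraph_def)

text \<open>Ends of edges lie in \<open>verts G\<close>, so lying in \<open>verts G - X\<close> is
  the same as not lying in \<open>X\<close>. This reduces questions about cuts to parity, for
  arbitrary \<open>X\<close>.\<close>

lemma in_cut_iff:
  assumes "multigraph G" "e \<in> edges G" "ends G e = {u, v}"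
  shows "e \<in> cutset G X \<longleftrightarrow> (u \<in> X) \<noteq> (v \<in> X)"
proof -
  have "u \<in> verts G" "v \<in> verts G"
    using assms by (auto simp: multigraph_def)
  then show ?thesis
    using assms(2,3) by (auto simp: cutset_def edges_between_def doubleton_eq_iff)
qed

lemma cocycles_eq: "cocycles G = cutset G ` Pow (verts G)"
  by (auto simp: cocycles_def cutset_def)

lemma sum_cut_singleton:
  assumes "multigraph G"
  shows "sum w (cutset G {x}) = wdegree G w x"
proof -
  have "cutset G {x} = {e \<in> edges G. x \<in> ends G e}"
  proof -
    have "e \<in> cutset G {x} \<longleftrightarrow> x \<in> ends G e" if e: "e \<in> edges G" for e
    proof -
      obtain u v where uv: "ends G e = {u, v}" "u \<noteq> v"
        using multigraph_edgeE[OF assms(1) e] by blast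
      then show ?thesis
        by (auto simp: in_cut_iff[OF assms(1) e uv(1)])
    qed
    then show ?thesis
      using cut_subset_edges[of G "{x}"] by blast
  qed
  then show ?thesis
    by (simp add: wdegree_def)
qed

subsection \<open>Flows and cuts\<close>

text \<open>Sum the net outflow over all vertices of \<open>X\<close> and exchange the sums. An edge
  inside \<open>X\<close> cancels by antisymmetry, an edge outside contributes nothing, and a cut
  edge contributes at most its capacity.\<close>

lemma flow_value_le_cut:
  assumes G: "multigraph G" and f: "is_flow G w x y f"
    and X: "X \<subseteq> verts G" "x \<in> X" "y \<notin> X"
  shows "flow_value G x f \<le> sum w (cutset G X)"
proof -
  have fin: "finite (edges G)" "finite X"
    using G X finite_subset by (auto simp: multigraph_def)
  let ?out = "\<lambda>z. \<Sum>e | e \<in> edges G \<and> z \<in> ends G e. f e z"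
  have "flow_value G x f = (\<Sum>z\<in>{x}. ?out z)"
    by (simp add: flow_value_def)
  \<comment> \<open>Every vertex of \<open>X\<close> other than \<open>x\<close> is also different
    from \<open>y\<close>, so conservation makes its term zero.\<close>
  also have "\<dots> = (\<Sum>z\<in>X. ?out z)"
    using f X fin by (intro sum.mono_neutral_left) (auto simp: is_flow_def)
  also have "\<dots> = (\<Sum>z\<in>X. \<Sum>e\<in>edges G. if z \<in> ends G e then f e z else 0)"
    using fin by (simp add: sum.inter_filter)
  also have "\<dots> = (\<Sum>e\<in>edges G. \<Sum>z\<in>X. if z \<in> ends G e then f e z else 0)"
    by (rule sum.swap)
  also have "\<dots> \<le> (\<Sum>e\<in>edges G. if e \<in> cutset G X then w e else 0)"
  proof (rule sum_mono)
    fix e assume e: "e \<in> edges G"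
    obtain u v where uv: "ends G e = {u, v}" "u \<noteq> v"
      using multigraph_edgeE[OF G e] by blast
    have "ends G e = {v, u}"
      using uv by blast
    then have fe: "f e u = - f e v" "\<bar>f e u\<bar> \<le> w e" "\<bar>f e v\<bar> \<le> w e"
      using f e uv(1) unfolding is_flow_def by metis+
    have "(\<Sum>z\<in>X. if z \<in> ends G e then f e z else 0) = (\<Sum>z\<in>X \<inter> {u, v}. f e z)"
      using fin uv(1) by (simp add: sum.inter_restrict)
    also have "\<dots> = (if u \<in> X then f e u else 0) + (if v \<in> X then f e v else 0)"
      using uv(2) by (simp add: Int_insert_right)
    also have "\<dots> \<le> (if e \<in> cutset G X then w e else 0)"
      using fe by (auto simp: in_cut_iff[OF G e uv(1)])
    finally show "(\<Sum>z\<in>X. if z \<in> ends G e then f e z else 0) \<le> (if e \<in> cutset G X then w e else 0)" .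
  qed
  also have "\<dots> = sum w (cutset G X)"
    using fin(1) cut_subset_edges[of G X] by (simp add: sum.If_cases Int_absorb1)
  finally show ?thesis .
qed

lemma flow_value_le_max_flow:
  assumes "multigraph G" "x \<in> verts G" "x \<noteq> y" "is_flow G w x y f"
  shows "flow_value G x f \<le> max_flow G w x y"
  unfolding max_flow_def
proof (rule cSup_upper)
  \<comment> \<open>The star of \<open>x\<close> bounds all flow values at once.\<close>
  show "bdd_above {flow_value G x f |f. is_flow G w x y f}"
    using flow_value_le_cut[of G w x y _ "{x}"] assms by (auto intro!: bdd_aboveI)
qed (use assms in auto)

lemma max_flow_le_cut:
  assumes "multigraph G" "\<forall>e\<in>edges G. 0 \<le> w e"
    and "X \<subseteq> verts G" "x \<in> X" "y \<notin> X"
  shows "max_flow G w x y \<le> sum w (cutset G X)"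
  unfolding max_flow_def
proof (rule cSup_least)
  \<comment> \<open>The zero flow respects the capacities because the weights are nonnegative; a
    supremum of the empty set would be unspecified.\<close>
  have "is_flow G w x y (\<lambda>_ _. 0)"
    using assms(2) by (auto simp: is_flow_def)
  then show "{flow_value G x f |f. is_flow G w x y f} \<noteq> {}"
    by blast
qed (auto intro: flow_value_le_cut[OF assms(1) _ assms(3-5)])

text \<open>A set and its complement have the same cut, so it does not matter which of the two
  vertices lies in \<open>X\<close>. Path functionals detect separation only in this unoriented
  form.\<close>

lemma max_flow_le_separating_cut:
  assumes "multigraph G" "\<forall>e\<in>edges G. 0 \<le> w e"
    and "X \<subseteq> verts G" "x \<in> verts G" "y \<in> verts G" "(x \<in> X) \<noteq> (y \<in> X)"
  shows "max_flow G w x y \<le> sum w (cutset G X)"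
proof (cases "x \<in> X")
  case True
  then show ?thesis
    using max_flow_le_cut[OF assms(1-3)] assms(6) by simp
next
  case False
  have "cutset G (verts G - X) = cutset G X"
  proof -
    have "e \<in> cutset G (verts G - X) \<longleftrightarrow> e \<in> cutset G X" if e: "e \<in> edges G" for e
    proof -
      obtain u v where uv: "ends G e = {u, v}" "u \<in> verts G" "v \<in> verts G"
        using multigraph_edgeE[OF assms(1) e] by blast
      then show ?thesis
        by (simp add: in_cut_iff[OF assms(1) e uv(1)])
    qed
    then show ?thesis
      using cut_subset_edges[of G X] cut_subset_edges[of G "verts G - X"] by blast
  qed
  then show ?thesis
    using False assms max_flow_le_cut[of G w "verts G - X" x y] by auto
qed

lemma edge_weight_le_max_flow:
  assumes G: "multigraph G" and w: "\<forall>e\<in>edges G. 0 \<le> w e"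
    and e: "e \<in> edges G" "ends G e = {x, y}"
  shows "w e \<le> max_flow G w x y"
proof -
  have xy: "x \<noteq> y" "x \<in> verts G"
    using G e by (auto simp: multigraph_def)
  \<comment> \<open>The whole capacity of \<open>e\<close> is sent from \<open>x\<close> to
    \<open>y\<close>; all other edges, including those parallel to \<open>e\<close>, carry
    nothing.\<close>
  define f where "f = (\<lambda>e' z. if e' = e then if z = x then w e else if z = y then - w e else 0 else 0)"
  have "is_flow G w x y f"
    using w e xy unfolding is_flow_def f_def by (auto simp: doubleton_eq_iff intro!: sum.neutral)
  moreover have "flow_value G x f = w e"
  proof -
    have "flow_value G x f = (\<Sum>e' | e' \<in> edges G \<and> x \<in> ends G e'. if e' = e then w e else 0)"
      by (simp add: flow_value_def f_def cong: if_cong)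
    then show ?thesis
      using G e by (simp add: multigraph_def)
  qed
  ultimately show ?thesis
    using flow_value_le_max_flow[OF G xy(2,1)] by metis
qed

subsection \<open>The cocycle space\<close>

lemma edge_vec_apply: "edge_vec C e = of_bool (e \<in> C)"
  by (simp add: edge_vec_def indicator_def)

lemma inj_edge_vec: "inj edge_vec"
  by (auto simp: inj_def edge_vec_apply fun_eq_iff)

text \<open>An edge is in a cut iff the indicator of the vertex set changes along it, and this
  change is additive mod 2.\<close>

lemma edge_vec_cut_add:
  assumes "multigraph G"
  shows "edge_vec (cutset G X) + edge_vec (cutset G Y) = edge_vec (cutset G (X - Y \<union> (Y - X)))"
proof
  fix e
  show "(edge_vec (cutset G X) + edge_vec (cutset G Y)) e = edge_vec (cutset G (X - Y \<union> (Y - X))) e"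
  proof (cases "e \<in> edges G")
    case True
    then obtain u v where "ends G e = {u, v}"
      using assms multigraph_edgeE by metis
    then show ?thesis
      using assms True by (auto simp: edge_vec_apply in_cut_iff)
  next
    case False
    then have "e \<notin> cutset G Z" for Z
      using cut_subset_edges[of G Z] by blast
    then show ?thesis
      by (simp add: edge_vec_apply)
  qed
qed

lemma edge_vec_empty: "edge_vec {} = 0"
  by (simp add: edge_vec_apply fun_eq_iff)

lemma gf2_scale_cases: "gf2_scale c f = 0 \<or> gf2_scale c f = f"
  by (cases c) (simp_all only: gf2.scale_zero_left gf2.scale_one simp_thms)

lemma subspace_cocycles:
  assumes "multigraph G"
  shows "gf2.subspace (edge_vec ` cocycles G)"
proof (rule gf2.subspaceI)
  have "cutset G {} = {}"
    by (simp add: cutset_def edges_between_def)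
  then have "edge_vec (cutset G {}) = 0"
    by (simp add: edge_vec_empty)
  then show zero: "0 \<in> edge_vec ` cocycles G"
    unfolding cocycles_eq by (metis Pow_bottom image_eqI)
  show "f + g \<in> edge_vec ` cocycles G"
    if "f \<in> edge_vec ` cocycles G" "g \<in> edge_vec ` cocycles G" for f g
  proof -
    obtain X Y where "X \<subseteq> verts G" "Y \<subseteq> verts G"
      "f = edge_vec (cutset G X)" "g = edge_vec (cutset G Y)"
      using \<open>f \<in> _\<close> \<open>g \<in> _\<close> by (auto simp: cocycles_eq)
    then show ?thesis
      by (auto simp: edge_vec_cut_add[OF assms] cocycles_eq)
  qed
  show "gf2_scale c f \<in> edge_vec ` cocycles G" if "f \<in> edge_vec ` cocycles G" for c f
    using gf2_scale_cases[of c f] zero that by metis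
qed

text \<open>The functional of a walk with edge list \<open>es\<close>. A repeated edge counts with
  multiplicity, so the walk need not be a simple path.\<close>

definition path_sum :: "'e list \<Rightarrow> ('e \<Rightarrow> bit) \<Rightarrow> bit" where
  "path_sum es f = (\<Sum>e\<leftarrow>es. f e)"

lemma path_sum_zero: "path_sum es 0 = 0"
  by (induction es) (simp_all add: path_sum_def)

lemma path_sum_add: "path_sum es (f + g) = path_sum es f + path_sum es g"
  by (simp only: path_sum_def plus_fun_apply sum_list_addf)

text \<open>The kernel of the functional is a subspace.\<close>

lemma path_sum_eq_0_on_span:
  assumes "f \<in> gf2.span S" "\<And>g. g \<in> S \<Longrightarrow> path_sum es g = 0"
  shows "path_sum es f = 0"
proof -
  have "gf2.subspace {g. path_sum es g = 0}"
    by (rule gf2.subspaceI)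
      (simp_all add: path_sum_zero path_sum_add, metis gf2_scale_cases path_sum_zero)
  then show ?thesis
    using assms gf2.span_minimal[of S "{g. path_sum es g = 0}"] by blast
qed

text \<open>Along a walk from \<open>x\<close> to \<open>y\<close>, membership in \<open>X\<close>
  changes exactly at the edges of the cut, so the parity of the changes is decided by the two ends.
  One list \<open>es\<close> serves all \<open>X\<close>.\<close>

lemma path_sum_cut:
  assumes "multigraph G" "connected_graph G" "x \<in> verts G" "y \<in> verts G"
  obtains es where "\<And>X. path_sum es (edge_vec (cutset G X)) = of_bool ((x \<in> X) \<noteq> (y \<in> X))"
proof -
  have "(x, y) \<in> (adj G)\<^sup>*"
    using assms(2-4) by (auto simp: connected_graph_def reach_def)
  then have "\<exists>es. \<forall>X. path_sum es (edge_vec (cutset G X)) = of_bool ((x \<in> X) \<noteq> (y \<in> X))"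
  proof (induction rule: rtrancl_induct)
    case base
    show ?case
      by (rule exI[of _ "[]"]) (simp add: path_sum_def)
  next
    case (step y z)
    then obtain es e where
      es: "\<And>X. path_sum es (edge_vec (cutset G X)) = of_bool ((x \<in> X) \<noteq> (y \<in> X))"
      and e: "e \<in> edges G" "ends G e = {y, z}"
      by (auto simp: adj_def)
    \<comment> \<open>The last edge of the extended walk goes to the front of the list, since the
      order does not affect the sum.\<close>
    have "path_sum (e # es) (edge_vec (cutset G X)) = of_bool ((x \<in> X) \<noteq> (z \<in> X))" for X
    proof -
      have "path_sum (e # es) (edge_vec (cutset G X)) =
          edge_vec (cutset G X) e + path_sum es (edge_vec (cutset G X))"
        by (simp add: path_sum_def)
      then show ?thesis
        by (auto simp: es edge_vec_apply in_cut_iff[OF assms(1) e])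
    qed
    then show ?case
      by blast
  qed
  then show thesis
    using that by blast
qed

lemma cocycle_basis_subset:
  assumes "cocycle_basis G B"
  shows "B \<subseteq> cocycles G"
proof -
  have "edge_vec ` B \<subseteq> edge_vec ` cocycles G"
    using assms gf2.span_superset[of "edge_vec ` B"] by (simp add: cocycle_basis_def)
  then show ?thesis
    by (simp add: inj_image_subset_iff[OF inj_edge_vec])
qed

lemma finite_cocycles: "multigraph G \<Longrightarrow> finite (cocycles G)"
  by (simp add: cocycles_eq multigraph_def)

text \<open>The functional of a walk from \<open>x\<close> to \<open>y\<close> is 1 on the star of
  \<open>x\<close>, which lies in the span of the basis, so it cannot vanish on every basis
  element.\<close>

lemma cocycle_basis_separates:
  assumes G: "multigraph G" "connected_graph G" and B: "cocycle_basis G B"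
    and xy: "x \<in> verts G" "y \<in> verts G" "x \<noteq> y"
  obtains X where "X \<subseteq> verts G" "cutset G X \<in> B" "(x \<in> X) \<noteq> (y \<in> X)"
proof -
  obtain es where es: "\<And>X. path_sum es (edge_vec (cutset G X)) = of_bool ((x \<in> X) \<noteq> (y \<in> X))"
    using path_sum_cut[OF G xy(1,2)] by blast
  have "edge_vec (cutset G {x}) \<in> gf2.span (edge_vec ` B)"
    using B xy(1) by (auto simp: cocycle_basis_def cocycles_eq)
  moreover have "path_sum es (edge_vec (cutset G {x})) \<noteq> 0"
    using xy(3) by (simp add: es)
  ultimately obtain C where "C \<in> B" "path_sum es (edge_vec C) \<noteq> 0"
    using path_sum_eq_0_on_span[of _ "edge_vec ` B" es] by blast
  moreover obtain X where "X \<subseteq> verts G" "C = cutset G X"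
    using \<open>C \<in> B\<close> cocycle_basis_subset[OF B] by (auto simp: cocycles_eq)
  ultimately show thesis
    using that[of X] es[of X] by auto
qed

subsection \<open>Trees\<close>

text \<open>Extend the path at its front. If the new vertex already occurs on it, keep only the part
  from that occurrence on.\<close>

lemma simple_path:
  assumes "(u, v) \<in> (adj G)\<^sup>*"
  obtains vs es where "vs \<noteq> []" "hd vs = u" "last vs = v" "length vs = Suc (length es)"
    "distinct vs" "set es \<subseteq> edges G" "\<forall>i<length es. ends G (es ! i) = {vs ! i, vs ! Suc i}"
proof -
  have "\<exists>vs es. vs \<noteq> [] \<and> hd vs = u \<and> last vs = v \<and> length vs = Suc (length es) \<and>
      distinct vs \<and> set es \<subseteq> edges G \<and> (\<forall>i<length es. ends G (es ! i) = {vs ! i, vs ! Suc i})"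
    using assms
  proof (induction rule: converse_rtrancl_induct)
    case base
    show ?case
      by (rule exI[of _ "[v]"], rule exI[of _ "[]"]) simp
  next
    case (step t u)
    then obtain vs es where p: "vs \<noteq> []" "hd vs = u" "last vs = v" "length vs = Suc (length es)"
      "distinct vs" "set es \<subseteq> edges G" "\<forall>i<length es. ends G (es ! i) = {vs ! i, vs ! Suc i}"
      by auto
    obtain e where e: "e \<in> edges G" "ends G e = {t, u}"
      using step(1) by (auto simp: adj_def)
    show ?case
    proof (cases "t \<in> set vs")
      case False
      have "ends G ((e # es) ! i) = {(t # vs) ! i, (t # vs) ! Suc i}" if "i < length (e # es)" for i
        using that p e by (cases i) (auto simp: hd_conv_nth)
      then show ?thesis
        using p e False by (intro exI[of _ "t # vs"] exI[of _ "e # es"]) auto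
    next
      case True
      then obtain k where k: "k < length vs" "vs ! k = t"
        by (auto simp: in_set_conv_nth)
      have "set (drop k es) \<subseteq> edges G"
        using p(6) set_drop_subset[of k es] by blast
      then show ?thesis
        using p k by (intro exI[of _ "drop k vs"] exI[of _ "drop k es"])
          (auto simp: hd_drop_conv_nth)
    qed
  qed
  then show thesis
    using that by blast
qed

text \<open>A simple path joining the ends of \<open>e\<close> and avoiding \<open>e\<close> would
  close up with \<open>e\<close> to a cycle.\<close>

lemma tree_edge_is_bridge:
  assumes T: "tree T" and e: "e \<in> edges T" "ends T e = {u, v}"
  shows "(u, v) \<notin> (adj (delete_edge T e))\<^sup>*"
proof
  assume "(u, v) \<in> (adj (delete_edge T e))\<^sup>*"
  then obtain vs es where p: "vs \<noteq> []" "hd vs = u" "last vs = v" "length vs = Suc (length es)"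
      "distinct vs" "set es \<subseteq> edges (delete_edge T e)"
      "\<forall>i<length es. ends (delete_edge T e) (es ! i) = {vs ! i, vs ! Suc i}"
    using simple_path by metis
  have mT: "multigraph T"
    using T by (simp add: tree_def)
  have es: "set es \<subseteq> edges T" "e \<notin> set es" "\<forall>i<length es. ends T (es ! i) = {vs ! i, vs ! Suc i}"
    using p(6,7) by (auto simp: delete_edge_def)
  have "u \<noteq> v" "u \<in> verts T"
    using mT e by (auto simp: multigraph_def)
  then have len: "length vs \<ge> 2"
    using p(1-4) by (cases es; cases vs) auto
  \<comment> \<open>Since the vertices are distinct, equal edges at different positions would force
    each position to be the successor of the other.\<close>
  have "distinct es"
    unfolding distinct_conv_nth
  proof (intro allI impI notI)
    fix i j assume ij: "i < length es" "j < length es" "i \<noteq> j" "es ! i = es ! j"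
    then have "{vs ! i, vs ! Suc i} = {vs ! j, vs ! Suc j}"
      using es(3) by metis
    then show False
      using ij p(4,5) by (auto simp: doubleton_eq_iff nth_eq_iff_index_eq)
  qed
  have "vs ! i \<in> verts T" if "i < length vs" for i
  proof (cases i)
    case 0
    then show ?thesis
      using p(1,2) \<open>u \<in> verts T\<close> by (simp add: hd_conv_nth)
  next
    case (Suc j)
    then have "es ! j \<in> edges T" "vs ! i \<in> ends T (es ! j)"
      using es that p(4) by auto
    then show ?thesis
      using mT by (auto simp: multigraph_def)
  qed
  then have vs: "set vs \<subseteq> verts T"
    by (auto simp: in_set_conv_nth)
  have "ends T ((es @ [e]) ! i) = {vs ! i, vs ! (Suc i mod length vs)}" if "i < length vs" for i
  proof (cases "i < length es")
    case True
    then show ?thesis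
      using es p(4) by (simp add: nth_append)
  next
    case False
    \<comment> \<open>At this last index the cyclic successor is position 0, so the closing edge
      \<open>e\<close> joins \<open>v\<close> to \<open>u\<close>.\<close>
    then have "i = length es"
      using that p(4) by simp
    then show ?thesis
      using p(1-4) e by (auto simp: nth_append last_conv_nth hd_conv_nth)
  qed
  then have "is_cycle T vs (es @ [e])"
    using len p(4,5) es e \<open>distinct es\<close> vs by (simp add: is_cycle_def)
  then show False
    using T by (auto simp: tree_def)
qed

lemma sym_adj: "sym (adj G)"
  by (auto simp: sym_def adj_def insert_commute)

lemma equiv_reach: "equiv (verts G) (reach G)"
proof (rule equivI)
  show "sym (reach G)"
    using symD[OF sym_rtrancl[OF sym_adj]] by (intro symI) (auto simp: reach_def)
  show "trans (reach G)"
    by (auto simp: reach_def trans_def)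
qed (auto simp: reach_def refl_on_def)

lemma edges_between_commute: "edges_between G X Y = edges_between G Y X"
  by (auto simp: edges_between_def insert_commute)

text \<open>\<open>X\<close> is the component of one end of \<open>e\<close> after deleting
  \<open>e\<close>. The same vertex set gives the cut \<open>{e}\<close> in \<open>T\<close> and the
  elementary cocycle in \<open>G\<close>, so statements about \<open>G\<close> can be decided in
  \<open>T\<close>.\<close>

lemma tree_edge_side:
  assumes T: "tree T" and e: "e \<in> edges T" and G: "verts G = verts T"
  obtains X where "X \<subseteq> verts T" "cutset T X = {e}" "elementary_cocycle G T e = cutset G X"
proof -
  have mT: "multigraph T" and cT: "connected_graph T"
    using T by (auto simp: tree_def)
  obtain u v where uv: "ends T e = {u, v}" "u \<noteq> v" "u \<in> verts T" "v \<in> verts T"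
    using multigraph_edgeE[OF mT e] by blast
  define D where "D = delete_edge T e"
  have vD: "verts D = verts T"
    by (simp add: D_def delete_edge_def)
  have eqv: "equiv (verts T) (reach D)"
    using equiv_reach[of D] by (simp add: vD)
  define X where "X = reach D `` {u}"
  define Y where "Y = reach D `` {v}"
  have "(u, v) \<notin> reach D"
    using tree_edge_is_bridge[OF T e uv(1)] by (simp add: reach_def D_def)
  then have "X \<noteq> Y"
    using eqv uv by (simp add: X_def Y_def eq_equiv_class_iff)
  then have "X \<inter> Y = {}"
    using quotient_disj[OF eqv quotientI[OF uv(3)] quotientI[OF uv(4)]]
    by (simp add: X_def Y_def)
  have adjD: "(s, t) \<in> adj D \<or> {s, t} = {u, v}" if "(s, t) \<in> adj T" for s t
    using that uv(1) by (auto simp: adj_def D_def delete_edge_def)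
  have closed: "t \<in> X \<longleftrightarrow> s \<in> X" "t \<in> Y \<longleftrightarrow> s \<in> Y"
    if "(s, t) \<in> adj D" "s \<in> verts T" "t \<in> verts T" for s t
  proof -
    have "(s, t) \<in> reach D"
      using that by (auto simp: reach_def vD)
    moreover have "(t, s) \<in> reach D"
      using calculation eqv by (meson equiv_def symD)
    moreover have "trans (reach D)"
      using eqv by (simp add: equiv_def)
    ultimately show "t \<in> X \<longleftrightarrow> s \<in> X" "t \<in> Y \<longleftrightarrow> s \<in> Y"
      unfolding X_def Y_def Image_singleton_iff by (meson transD)+
  qed
  have uvXY: "u \<in> X" "v \<in> Y"
    using uv eqv by (auto simp: X_def Y_def reach_def vD)
  have XYsub: "X \<subseteq> verts T" "Y \<subseteq> verts T"
    by (auto simp: X_def Y_def reach_def vD)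
  \<comment> \<open>Follow a walk of \<open>T\<close> from \<open>u\<close>: a step either stays in
    its class or joins \<open>u\<close> and \<open>v\<close>, which both lie in the union.\<close>
  have "t \<in> X \<union> Y" if "t \<in> verts T" for t
  proof -
    have "(u, t) \<in> (adj T)\<^sup>*"
      using cT uv that by (auto simp: connected_graph_def reach_def)
    then show ?thesis
    proof (induction rule: rtrancl_induct)
      case (step s t)
      have "s \<in> verts T" "t \<in> verts T"
        using step(2) mT by (auto simp: adj_def multigraph_def)
      with step adjD[of s t] closed[of s t] uvXY show ?case
        by (auto simp: doubleton_eq_iff)
    qed (use uvXY in auto)
  qed
  with XYsub \<open>X \<inter> Y = {}\<close> have Y: "Y = verts T - X"
    by blast
  have "e' \<in> cutset T X \<longleftrightarrow> e' = e" if e': "e' \<in> edges T" for e'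
  proof (cases "e' = e")
    case True
    then show ?thesis
      using in_cut_iff[OF mT e uv(1)] uvXY Y by blast
  next
    case False
    obtain s t where st: "ends T e' = {s, t}" "s \<in> verts T" "t \<in> verts T"
      using multigraph_edgeE[OF mT e'] by blast
    then have "(s, t) \<in> adj D"
      using e' False by (auto simp: adj_def D_def delete_edge_def)
    then show ?thesis
      using closed(1) in_cut_iff[OF mT e' st(1)] st False by blast
  qed
  then have "cutset T X = {e}"
    using e cut_subset_edges[of T X] by blast
  have comp: "components D = {X, Y}"
  proof -
    have "reach D `` {t} \<in> {X, Y}" if "t \<in> verts T" for t
    proof -
      have "t \<in> X \<or> t \<in> Y"
        using that Y by blast
      then show ?thesis
        using eqv unfolding X_def Y_def by (metis Image_singleton_iff equiv_class_eq insertCI)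
    qed
    then show ?thesis
      using uv by (auto simp: components_def quotient_def vD X_def Y_def)
  qed
  have "elementary_cocycle G T e = cutset G X"
    unfolding elementary_cocycle_def
  proof (rule the_equality)
    show "\<exists>X' Y'. X' \<noteq> Y' \<and> components (delete_edge T e) = {X', Y'} \<and>
        cutset G X = edges_between G X' Y'"
      using \<open>X \<noteq> Y\<close> comp Y G unfolding D_def cutset_def by metis
  next
    fix C assume "\<exists>X' Y'. X' \<noteq> Y' \<and> components (delete_edge T e) = {X', Y'} \<and>
      C = edges_between G X' Y'"
    \<comment> \<open>The two components may appear in either order, hence the symmetry of
      \<open>edges_between\<close>.\<close>
    then show "C = cutset G X"
      using comp Y G edges_between_commute[of G X Y]
      by (auto simp: D_def cutset_def doubleton_eq_iff)
  qed
  with XYsub(1) \<open>cutset T X = {e}\<close> show thesis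
    using that by blast
qed

text \<open>If no edge leaves \<open>X\<close>, membership in \<open>X\<close> is inherited along
  walks. This is the base case when elementary cocycles are shown to span.\<close>

lemma connected_cut_empty:
  assumes "connected_graph T" "multigraph T" "X \<subseteq> verts T" "cutset T X = {}"
  shows "X = {} \<or> X = verts T"
proof -
  have "t \<in> X" if "s \<in> X" "(s, t) \<in> (adj T)\<^sup>*" for s t
    using that(2,1)
  proof (induction rule: rtrancl_induct)
    case (step y z)
    then obtain e where "e \<in> edges T" "ends T e = {y, z}"
      by (auto simp: adj_def)
    then show ?case
      using in_cut_iff[OF assms(2), of e y z X] assms(4) step by auto
  qed
  moreover have "(s, t) \<in> (adj T)\<^sup>*" if "s \<in> verts T" "t \<in> verts T" for s t
    using assms(1) that by (auto simp: connected_graph_def reach_def)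
  ultimately show ?thesis
    using assms(3) by blast
qed

lemma elementary_cocycles_basis:
  assumes G: "multigraph G" "connected_graph G" and T: "tree T" "verts T = verts G"
  shows "cocycle_basis G (elementary_cocycle G T ` edges T)"
proof -
  have mT: "multigraph T" and cT: "connected_graph T"
    using T by (auto simp: tree_def)
  have "\<exists>X. X \<subseteq> verts T \<and> cutset T X = {e} \<and> elementary_cocycle G T e = cutset G X"
    if "e \<in> edges T" for e
    using tree_edge_side[OF T(1) that] T(2) by metis
  then obtain S where S: "\<And>e. e \<in> edges T \<Longrightarrow> S e \<subseteq> verts T"
      "\<And>e. e \<in> edges T \<Longrightarrow> cutset T (S e) = {e}"
      "\<And>e. e \<in> edges T \<Longrightarrow> elementary_cocycle G T e = cutset G (S e)"
    by metis
  let ?B = "elementary_cocycle G T ` edges T"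
  have "gf2.independent (edge_vec ` ?B)"
    unfolding gf2.dependent_def
  proof clarify
    fix e assume e: "e \<in> edges T"
      and dep: "edge_vec (elementary_cocycle G T e) \<in>
        gf2.span (edge_vec ` ?B - {edge_vec (elementary_cocycle G T e)})"
    obtain u v where uv: "ends T e = {u, v}" "u \<in> verts T" "v \<in> verts T"
      using multigraph_edgeE[OF mT e] by blast
    obtain es where es: "\<And>X. path_sum es (edge_vec (cutset G X)) = of_bool ((u \<in> X) \<noteq> (v \<in> X))"
      using path_sum_cut[OF G] uv T(2) by metis
    \<comment> \<open>\<open>S e'\<close> separates the ends of \<open>e\<close> iff
      \<open>e\<close> lies in its cut in \<open>T\<close>, which is \<open>{e'}\<close>.\<close>
    have dual: "path_sum es (edge_vec (elementary_cocycle G T e')) = of_bool (e' = e)"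
      if "e' \<in> edges T" for e'
      using in_cut_iff[OF mT e uv(1), of "S e'"] that S(2,3)[OF that] by (auto simp: es)
    \<comment> \<open>The remaining vectors come from tree edges other than \<open>e\<close>, where
      the functional vanishes; on the vector of \<open>e\<close> itself it is 1.\<close>
    have "path_sum es (edge_vec (elementary_cocycle G T e)) = 0"
      using dep by (rule path_sum_eq_0_on_span) (auto simp: dual)
    then show False
      by (simp add: dual e)
  qed
  moreover have "gf2.span (edge_vec ` ?B) = edge_vec ` cocycles G"
  proof
    have "?B \<subseteq> cocycles G"
      using S T(2) by (auto simp: cocycles_eq)
    then show "gf2.span (edge_vec ` ?B) \<subseteq> edge_vec ` cocycles G"
      using subspace_cocycles[OF G(1)] by (intro gf2.span_minimal image_mono)
    \<comment> \<open>Adding the elementary cocycle of a tree edge in the cut removes exactly this edge from it.\<close>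
    have "edge_vec (cutset G X) \<in> gf2.span (edge_vec ` ?B)" if "X \<subseteq> verts G" for X
      using that
    proof (induction "card (cutset T X)" arbitrary: X rule: less_induct)
      case less
      show ?case
      proof (cases "cutset T X = {}")
        case True
        then have "X = {} \<or> X = verts G"
          using connected_cut_empty[OF cT mT] less.prems T(2) by simp
        then have "cutset G X = {}"
          by (auto simp: cutset_def edges_between_def)
        then show ?thesis
          by (simp add: edge_vec_empty gf2.span_zero)
      next
        case False
        then obtain e where eX: "e \<in> cutset T X"
          by blast
        then have e: "e \<in> edges T"
          using cut_subset_edges[of T X] by blast
        define Z where "Z = X - S e \<union> (S e - X)"
        have "edge_vec (cutset T Z) = edge_vec (cutset T X) + edge_vec {e}"
          using edge_vec_cut_add[OF mT, of X "S e"] S(2)[OF e] by (simp add: Z_def)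
        also have "\<dots> = edge_vec (cutset T X - {e})"
          using eX by (auto simp: fun_eq_iff edge_vec_apply)
        finally have "cutset T Z = cutset T X - {e}"
          using injD[OF inj_edge_vec] by blast
        then have "card (cutset T Z) < card (cutset T X)"
          using eX finite_cut[OF mT] by (metis card_Diff1_less)
        moreover have "Z \<subseteq> verts G"
          using less.prems S(1)[OF e] T(2) by (auto simp: Z_def)
        ultimately have "edge_vec (cutset G Z) \<in> gf2.span (edge_vec ` ?B)"
          by (rule less.hyps)
        moreover have "edge_vec (cutset G (S e)) \<in> gf2.span (edge_vec ` ?B)"
          using e S(3)[OF e] by (intro gf2.span_base) auto
        \<comment> \<open>Symmetric difference with \<open>S e\<close> is an involution, so
          \<open>X\<close> is recovered from \<open>Z\<close> and additivity can be applied in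
          \<open>G\<close>.\<close>
        moreover have "X = Z - S e \<union> (S e - Z)"
          by (auto simp: Z_def)
        then have "edge_vec (cutset G X) = edge_vec (cutset G Z) + edge_vec (cutset G (S e))"
          using edge_vec_cut_add[OF G(1), of Z "S e"] by simp
        ultimately show ?thesis
          by (simp add: gf2.span_add)
      qed
    qed
    then show "edge_vec ` cocycles G \<subseteq> gf2.span (edge_vec ` ?B)"
      by (auto simp: cocycles_eq)
  qed
  ultimately show ?thesis
    by (simp add: cocycle_basis_def)
qed

subsection \<open>Comparison of the parameters\<close>

lemma max0_ge: "finite A \<Longrightarrow> a \<in> A \<Longrightarrow> a \<le> max0 A"
  by (auto simp: max0_def)

lemma max0_least: "finite A \<Longrightarrow> (\<And>a. a \<in> A \<Longrightarrow> a \<le> b) \<Longrightarrow> 0 \<le> b \<Longrightarrow> max0 A \<le> b"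
  by (auto simp: max0_def)

lemma max0_nonneg: "finite A \<Longrightarrow> (\<And>a. a \<in> A \<Longrightarrow> 0 \<le> a) \<Longrightarrow> 0 \<le> max0 A"
  by (auto simp: max0_def Max_ge_iff)

lemma finite_max_flows:
  assumes "multigraph G"
  shows "finite {max_flow G w x y | x y. x \<in> verts G \<and> y \<in> verts G \<and> x \<noteq> y}"
proof -
  have "{max_flow G w x y | x y. x \<in> verts G \<and> y \<in> verts G \<and> x \<noteq> y}
      \<subseteq> (\<lambda>(x, y). max_flow G w x y) ` (verts G \<times> verts G)"
    by auto
  then show ?thesis
    using assms finite_subset by (fastforce simp: multigraph_def)
qed

lemma max_flow_le_maxmaxflow:
  assumes "multigraph G" "x \<in> verts G" "y \<in> verts G" "x \<noteq> y"
  shows "max_flow G w x y \<le> maxmaxflow G w"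
  unfolding maxmaxflow_def by (rule max0_ge[OF finite_max_flows[OF assms(1)]]) (use assms in auto)

lemma maxmaxflow_le:
  assumes "multigraph G" "0 \<le> b"
    and "\<And>x y. x \<in> verts G \<Longrightarrow> y \<in> verts G \<Longrightarrow> x \<noteq> y \<Longrightarrow> max_flow G w x y \<le> b"
  shows "maxmaxflow G w \<le> b"
  unfolding maxmaxflow_def
  by (rule max0_least[OF finite_max_flows[OF assms(1)]]) (use assms in blast)+

text \<open>Each pair of vertices is separated by some basis element, possibly a different one for
  each pair, and its weight bounds the flow.\<close>

lemma maxmaxflow_le_cocycle_basis:
  assumes G: "multigraph G" "connected_graph G" and w: "\<forall>e\<in>edges G. 0 \<le> w e"
    and B: "cocycle_basis G B"
  shows "maxmaxflow G w \<le> max0 (sum w ` B)"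
proof -
  have fin: "finite (sum w ` B)"
    using cocycle_basis_subset[OF B] finite_cocycles[OF G(1)] finite_subset by blast
  have nn: "0 \<le> sum w C" if "C \<in> B" for C
    using that cocycle_basis_subset[OF B] w
    by (intro sum_nonneg) (auto simp: cocycles_eq dest: set_mp[OF cut_subset_edges])
  show ?thesis
  proof (rule maxmaxflow_le[OF G(1)])
    \<comment> \<open>This covers a graph with a single vertex, where there are no pairs and
      \<open>maxmaxflow\<close> is 0.\<close>
    show "0 \<le> max0 (sum w ` B)"
      using fin nn by (intro max0_nonneg) auto
    fix x y assume xy: "x \<in> verts G" "y \<in> verts G" "x \<noteq> y"
    obtain X where X: "X \<subseteq> verts G" "cutset G X \<in> B" "(x \<in> X) \<noteq> (y \<in> X)"
      using cocycle_basis_separates[OF G B xy] by blast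
    have "max_flow G w x y \<le> sum w (cutset G X)"
      using max_flow_le_separating_cut[OF G(1) w X(1) xy(1,2) X(3)] .
    also have "\<dots> \<le> max0 (sum w ` B)"
      using fin X(2) by (intro max0_ge) auto
    finally show "max_flow G w x y \<le> max0 (sum w ` B)" .
  qed
qed

text \<open>The edge alone is a cut separating its ends, and the flow along it attains the capacity
  of this cut.\<close>

lemma tree_max_flow_adjacent:
  assumes T: "tree T" and w: "\<forall>e\<in>edges T. 0 \<le> w e" and e: "e \<in> edges T" "ends T e = {x, y}"
  shows "max_flow T w x y = w e"
proof -
  have mT: "multigraph T"
    using T by (simp add: tree_def)
  then have xy: "x \<in> verts T" "y \<in> verts T"
    using e by (auto simp: multigraph_def)
  obtain X where X: "X \<subseteq> verts T" "cutset T X = {e}"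
    using tree_edge_side[OF T e(1) refl] by metis
  have "(x \<in> X) \<noteq> (y \<in> X)"
    using in_cut_iff[OF mT e, of X] X(2) by simp
  then have "max_flow T w x y \<le> w e"
    using max_flow_le_separating_cut[OF mT w X(1) xy] X(2) by simp
  moreover have "w e \<le> max_flow T w x y"
    using edge_weight_le_max_flow[OF mT w e] .
  ultimately show ?thesis
    by simp
qed

section \<open>Gomory--Hu trees and the three maxmaxflow parameters\<close>

lemma gomory_hu_treeD:
  assumes "gomory_hu_tree G w T wT"
  shows "tree T" "verts T = verts G" "\<forall>e\<in>edges T. 0 \<le> wT e"
    and "x \<in> verts G \<Longrightarrow> y \<in> verts G \<Longrightarrow> x \<noteq> y \<Longrightarrow> max_flow G w x y = max_flow T wT x y"
    and "e \<in> edges T \<Longrightarrow> ends T e = {x, y} \<Longrightarrow> sum w (elementary_cocycle G T e) = max_flow G w x y"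
proof -
  note gh = assms[unfolded gomory_hu_tree_def]
  show "tree T" "verts T = verts G" "\<forall>e\<in>edges T. 0 \<le> wT e"
    using gh[THEN conjunct1] gh[THEN conjunct2, THEN conjunct1]
      gh[THEN conjunct2, THEN conjunct2, THEN conjunct1] .
  show "max_flow G w x y = max_flow T wT x y" if "x \<in> verts G" "y \<in> verts G" "x \<noteq> y"
    using gh[THEN conjunct2, THEN conjunct2, THEN conjunct2, THEN conjunct1] that by blast
  show "sum w (elementary_cocycle G T e) = max_flow G w x y" if "e \<in> edges T" "ends T e = {x, y}"
    using gh[THEN conjunct2, THEN conjunct2, THEN conjunct2, THEN conjunct2, rule_format, OF that] .
qed

text \<open>Flow equivalence, together with the maximum flow between adjacent vertices of a tree,
  identifies \<open>wT e\<close> with a flow in \<open>G\<close>; the cocycle condition then gives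
  the elementary cocycle the same weight.\<close>

lemma gomory_hu_tree_edge:
  assumes "gomory_hu_tree G w T wT" "e \<in> edges T"
  obtains x y where "x \<in> verts G" "y \<in> verts G" "x \<noteq> y" "ends T e = {x, y}"
    "wT e = max_flow G w x y" "sum w (elementary_cocycle G T e) = wT e"
proof -
  note T = gomory_hu_treeD[OF assms(1)]
  have mT: "multigraph T"
    using T(1) by (simp add: tree_def)
  obtain x y where xy: "x \<in> verts G" "y \<in> verts G" "x \<noteq> y" "ends T e = {x, y}"
    using multigraph_edgeE[OF mT assms(2)] T(2) by metis
  moreover have "wT e = max_flow G w x y"
    using tree_max_flow_adjacent[OF T(1,3) assms(2) xy(4)] T(4)[OF xy(1-3)] by simp
  moreover have "sum w (elementary_cocycle G T e) = max_flow G w x y"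
    using T(5)[OF assms(2) xy(4)] .
  ultimately show thesis
    using that by metis
qed

lemma gomory_hu_basis_weight:
  assumes "gomory_hu_tree G w T wT"
  shows "max0 (sum w ` elementary_cocycle G T ` edges T) = Lambda_hat T wT"
proof -
  have "sum w ` elementary_cocycle G T ` edges T = wT ` edges T"
    unfolding image_image by (intro image_cong refl) (rule gomory_hu_tree_edge[OF assms])
  then show ?thesis
    by (simp add: Lambda_hat_def)
qed

lemma maxmaxflow_nonneg:
  assumes "multigraph G" "\<forall>e\<in>edges G. 0 \<le> w e"
  shows "0 \<le> maxmaxflow G w"
  unfolding maxmaxflow_def
proof (intro max0_nonneg finite_max_flows assms(1), clarify)
  fix x y assume "x \<in> verts G" "x \<noteq> y"
  moreover have "is_flow G w x y (\<lambda>_ _. 0)"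
    using assms(2) by (auto simp: is_flow_def)
  ultimately show "0 \<le> max_flow G w x y"
    using flow_value_le_max_flow[OF assms(1), of x y w "\<lambda>_ _. 0"] by (simp add: flow_value_def)
qed

text \<open>The elementary cocycles of \<open>T\<close> form a basis whose weights are the tree
  weights, which gives one inequality; each tree weight is itself a flow between two vertices of
  \<open>G\<close>, which gives the other.\<close>

lemma maxmaxflow_eq_Lambda_hat:
  assumes G: "multigraph G" "connected_graph G" and w: "\<forall>e\<in>edges G. 0 \<le> w e"
    and T: "gomory_hu_tree G w T wT"
  shows "maxmaxflow G w = Lambda_hat T wT"
proof (rule antisym)
  have tT: "tree T" "verts T = verts G"
    using gomory_hu_treeD(1,2)[OF T] by blast+
  show "maxmaxflow G w \<le> Lambda_hat T wT"
    using maxmaxflow_le_cocycle_basis[OF G w elementary_cocycles_basis[OF G tT]]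
    by (simp add: gomory_hu_basis_weight[OF T])
  have "wT e \<le> maxmaxflow G w" if "e \<in> edges T" for e
    using gomory_hu_tree_edge[OF T that] max_flow_le_maxmaxflow[OF G(1)] by (metis (no_types))
  moreover have "finite (edges T)"
    using tT by (simp add: tree_def multigraph_def)
  ultimately show "Lambda_hat T wT \<le> maxmaxflow G w"
    unfolding Lambda_hat_def using maxmaxflow_nonneg[OF G(1) w] by (intro max0_least) auto
qed

lemma maxmaxflow_eq_Lambda_tilde:
  assumes G: "multigraph G" "connected_graph G" and w: "\<forall>e\<in>edges G. 0 \<le> w e"
    and T: "gomory_hu_tree G w T wT"
  shows "Lambda_tilde G w = maxmaxflow G w"
  unfolding Lambda_tilde_def
proof (rule Min_eqI)
  \<comment> \<open>Bases are subsets of the finite set of cocycles, so \<open>Min\<close> is taken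
    over a finite set.\<close>
  have "{max0 (sum w ` B) |B. cocycle_basis G B} \<subseteq> (\<lambda>B. max0 (sum w ` B)) ` Pow (cocycles G)"
    using cocycle_basis_subset by blast
  then show "finite {max0 (sum w ` B) |B. cocycle_basis G B}"
    by (rule finite_subset) (simp add: finite_cocycles[OF G(1)])
  show "maxmaxflow G w \<le> b" if "b \<in> {max0 (sum w ` B) |B. cocycle_basis G B}" for b
    using that maxmaxflow_le_cocycle_basis[OF G w] by blast
  have "tree T" "verts T = verts G"
    using gomory_hu_treeD(1,2)[OF T] by blast+
  then have "cocycle_basis G (elementary_cocycle G T ` edges T)"
    by (rule elementary_cocycles_basis[OF G])
  moreover have "max0 (sum w ` elementary_cocycle G T ` edges T) = maxmaxflow G w"
    using maxmaxflow_eq_Lambda_hat[OF G w T] by (simp add: gomory_hu_basis_weight[OF T])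
  ultimately show "maxmaxflow G w \<in> {max0 (sum w ` B) |B. cocycle_basis G B}"
    by (intro CollectI exI[of _ "elementary_cocycle G T ` edges T"]) simp
qed

section \<open>Degree bounds\<close>

lemma wdegree_nonneg: "\<forall>e\<in>edges G. 0 \<le> w e \<Longrightarrow> 0 \<le> wdegree G w x"
  unfolding wdegree_def by (rule sum_nonneg) blast

lemma maxmaxflow_le_Delta2:
  assumes G: "multigraph G" "verts G \<noteq> {}" and w: "\<forall>e\<in>edges G. 0 \<le> w e"
  shows "maxmaxflow G w \<le> Delta2 G w"
proof -
  have fin: "finite (verts G)"
    using G by (simp add: multigraph_def)
  have "maxmaxflow G w \<le> max0 (wdegree G w ` (verts G - {x1}))" for x1
  proof (rule maxmaxflow_le[OF G(1)])
    show "0 \<le> max0 (wdegree G w ` (verts G - {x1}))"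
      using fin wdegree_nonneg[OF w] by (intro max0_nonneg) auto
    fix x y assume xy: "x \<in> verts G" "y \<in> verts G" "x \<noteq> y"
    \<comment> \<open>At least one of two distinct vertices differs from \<open>x1\<close>, and its
      star separates them.\<close>
    then obtain z where z: "z \<in> verts G - {x1}" "z = x \<or> z = y"
      by blast
    then have "max_flow G w x y \<le> sum w (cutset G {z})"
      using xy by (intro max_flow_le_separating_cut[OF G(1) w]) auto
    also have "\<dots> = wdegree G w z"
      using sum_cut_singleton[OF G(1)] z by simp
    also have "\<dots> \<le> max0 (wdegree G w ` (verts G - {x1}))"
      using fin z by (intro max0_ge) auto
    finally show "max_flow G w x y \<le> max0 (wdegree G w ` (verts G - {x1}))" .
  qed
  then show ?thesis
    unfolding Delta2_def using fin G(2) by (intro Min.boundedI) auto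
qed

lemma Delta2_le_Delta:
  assumes G: "multigraph G" "verts G \<noteq> {}" and w: "\<forall>e\<in>edges G. 0 \<le> w e"
  shows "Delta2 G w \<le> Delta G w"
proof -
  have fin: "finite (verts G)"
    using G by (simp add: multigraph_def)
  obtain x where x: "x \<in> verts G"
    using G(2) by blast
  have deg: "wdegree G w z \<le> Delta G w" if "z \<in> verts G" for z
    unfolding Delta_def using that fin by simp
  have "Delta2 G w \<le> max0 (wdegree G w ` (verts G - {x}))"
    unfolding Delta2_def using fin x by (intro Min_le) auto
  also have "\<dots> \<le> Delta G w"
    \<comment> \<open>Nonnegativity of \<open>Delta G w\<close> is required when \<open>x\<close> is
      the only vertex and the maximum over the others is 0 by convention.\<close>
    using fin deg order_trans[OF wdegree_nonneg[OF w] deg[OF x]] by (intro max0_least) auto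
  finally show ?thesis .
qed

theorem theorem2p8:
  fixes G :: "('v, 'e) mgraph" and w :: "'e \<Rightarrow> real"
    and T :: "('v, 'f) mgraph" and wT :: "'f \<Rightarrow> real"
  assumes "multigraph G" and "connected_graph G"
    and "\<forall>e\<in>edges G. 0 \<le> w e"
    and "gomory_hu_tree G w T wT"
  shows "maxmaxflow G w = Lambda_hat T wT \<and>
    Lambda_hat T wT = Lambda_tilde G w \<and>
    Lambda_tilde G w \<le> Delta2 G w \<and>
    Delta2 G w \<le> Delta G w \<and>
    (\<forall>(T' :: ('v, 'g) mgraph) wT'.
       gomory_hu_tree G w T' wT' \<longrightarrow> Lambda_hat T' wT' = Lambda_hat T wT)"
proof -
  have "verts G \<noteq> {}"
    using assms(2) by (simp add: connected_graph_def)
  \<comment> \<open>Since \<open>maxmaxflow G w\<close> does not mention a tree, its equality with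
    \<open>Lambda_hat\<close> for every Gomory--Hu tree gives the independence claim, also for
    another type of tree edges.\<close>
  then show ?thesis
    using maxmaxflow_eq_Lambda_hat[OF assms(1-3)] maxmaxflow_eq_Lambda_tilde[OF assms]
      maxmaxflow_le_Delta2[OF assms(1) _ assms(3)] Delta2_le_Delta[OF assms(1) _ assms(3)] assms(4)
    by metis
qed

end
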